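(* Let $a,b,c\ge 0$ with $a+b+c>\frac n2$ and $c<\frac{n-1}{4}$. Let $\Delta$ denote either $\Delta_+$ or $\Delta_-$, where for $\xi,\eta\in\mathbb{R}^n$ $$\Delta_+(\xi,\eta)=|\xi|+|\eta|-|\xi+\eta|,\qquad \Delta_-(\xi,\eta)=|\xi+\eta|-\bigl||\xi|-|\eta|\bigr|.$$ Then there is a constant $C$ such that $$\int_{\mathbb{R}^n\times\mathbb{R}^n}\frac{f(\xi)\,g(\eta)\,h(\xi+\eta)}{\langle\xi\rangle^a\langle\eta\rangle^b\bigl(1+\Delta(\xi,\eta)\bigr)^c}\,d\xi\,d\eta\le C\,\|f\|_{L^2}\|g\|_{L^2}\|h\|_{L^2}$$ for all $f,g,h\in L^2(\mathbb{R}^n)$.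
   Context: $\langle\xi\rangle=1+|\xi|$. The constant $C$ may depend on $n,a,b,c$ but not on $f,g,h$. *)

theory Defs
  imports "HOL-Analysis.Analysis"
begin

definition bracket :: "real ^ 'n \<Rightarrow> real" where
  "bracket x = 1 + norm x"

definition Delta_plus :: "real ^ 'n \<Rightarrow> real ^ 'n \<Rightarrow> real" where
  "Delta_plus x y = norm x + norm y - norm (x + y)"

definition Delta_minus :: "real ^ 'n \<Rightarrow> real ^ 'n \<Rightarrow> real" where
  "Delta_minus x y = norm (x + y) - \<bar>norm x - norm y\<bar>"

text \<open>
  Elements of \<open>L2_fun\<close> are functions, not classes modulo null sets; measurability is
  with respect to the completed Lebesgue measure.
\<close>

definition L2_fun :: "(real ^ 'n \<Rightarrow> real) set" where
  "L2_fun = {f. f \<in> borel_measurable lebesgue \<and> integrable lebesgue (\<lambda>x. (f x)\<^sup>2)}"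

definition L2_norm :: "(real ^ 'n \<Rightarrow> real) \<Rightarrow> real" where
  "L2_norm f = sqrt (integral\<^sup>L lebesgue (\<lambda>x. (f x)\<^sup>2))"

definition trilinear_integrand ::
  "(real ^ 'n \<Rightarrow> real ^ 'n \<Rightarrow> real) \<Rightarrow> real \<Rightarrow> real \<Rightarrow> real \<Rightarrow>
   (real ^ 'n \<Rightarrow> real) \<Rightarrow> (real ^ 'n \<Rightarrow> real) \<Rightarrow> (real ^ 'n \<Rightarrow> real) \<Rightarrow>
   (real ^ 'n) \<times> (real ^ 'n) \<Rightarrow> real" where
  "trilinear_integrand \<Delta> a b c f g h = (\<lambda>(\<xi>, \<eta>).
     f \<xi> * g \<eta> * h (\<xi> + \<eta>) /
     (bracket \<xi> powr a * bracket \<eta> powr b * (1 + \<Delta> \<xi> \<eta>) powr c))"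

end

theory Submission
  imports Defs
begin

text \<open>
  On the region \<open>|\<xi>| \<le> |\<eta>|\<close>, Cauchy--Schwarz with the factors \<open>f(\<xi>) h(\<xi> + \<eta>)\<close> and
  \<open>g(\<eta>) W(\<xi>, \<eta>)\<close>, where \<open>W\<close> is the kernel cut off to that region, reduces the estimate to a bound
  for \<open>\<integral> W(\<xi>, \<eta>)\<^sup>2 d\<xi>\<close> that is uniform in \<open>\<eta>\<close>; the other region is symmetric.
  There \<open>1 + \<Delta>(\<xi>, \<eta>) \<ge> V/2\<close> with \<open>V = 1 + |\<xi>| - \<xi> \<bullet> w\<close>, where \<open>w\<close> is the unit vector along
  \<open>\<eta>\<close> (for \<open>\<Delta>\<^sub>+\<close>) or \<open>-\<eta>\<close> (for \<open>\<Delta>\<^sub>-\<close>), so it remains to integrate \<open>R powr -p * V powr -q\<close>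
  with \<open>R = 1 + |\<xi>|\<close>, \<open>p = 2(a + b)\<close>, \<open>q = 2c\<close>.
  Polar coordinates are avoided: for a coordinate \<open>j\<close> in which \<open>w\<close> is large, the sheared coordinates
  \<open>y\<^sub>i = \<xi>\<^sub>i - (w\<^sub>i / w\<^sub>j) \<xi>\<^sub>j\<close>, \<open>i \<noteq> j\<close>, satisfy \<open>1 + |y\<^sub>i| \<lesssim> R\<close> and \<open>(1 + |y\<^sub>i|)\<^sup>2 \<lesssim> R V\<close>.
  Hence the integrand is dominated by a product of functions \<open>(1 + |t|) powr -(1 + e)\<close> of
  \<open>\<xi>\<^sub>j\<close> and the \<open>y\<^sub>i\<close>, with \<open>e = (p + q - n)/n\<close>; the condition \<open>c < (n - 1)/4\<close> keeps the power of \<open>R\<close>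
  that is traded for each \<open>y\<^sub>i\<close> nonnegative.
\<close>

section \<open>Integrals on the line and of sheared products\<close>

lemma nn_integral_one_plus_abs_powr_finite:
  fixes e :: real
  assumes "e > 0"
  shows "(\<integral>\<^sup>+x. ennreal ((1 + \<bar>x\<bar>) powr - (1 + e)) \<partial>lborel) < \<infinity>"
proof -
  let ?f = "\<lambda>x::real. (1 + \<bar>x\<bar>) powr - (1 + e)"
  let ?F = "\<lambda>x::real. - ((1 + x) powr (- e)) / e"
  have "(\<integral>\<^sup>+x. ennreal (?f x) * indicator {0..} x \<partial>lborel)
      = (\<integral>\<^sup>+x. ennreal ((1 + x) powr - (1 + e)) * indicator {0..} x \<partial>lborel)"
    by (intro nn_integral_cong) (auto split: split_indicator)
  also have "\<dots> = ennreal (0 - ?F 0)"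
  proof (rule nn_integral_FTC_atLeast)
    fix x :: real assume "0 \<le> x"
    then show "(?F has_real_derivative (1 + x) powr - (1 + e)) (at x)"
      using assms by (auto intro!: derivative_eq_intros simp: field_simps minus_diff_commute)
  next
    have "((\<lambda>x. (1 + x) powr (- e)) \<longlongrightarrow> 0) at_top"
      by (rule tendsto_neg_powr, use assms in simp)
         (rule filterlim_tendsto_add_at_top[OF tendsto_const filterlim_ident])
    from tendsto_divide_zero[OF tendsto_minus[OF this, simplified]]
    show "(?F \<longlongrightarrow> 0) at_top" .
  qed auto
  finally have half: "(\<integral>\<^sup>+x. ennreal (?f x) * indicator {0..} x \<partial>lborel) < \<infinity>"
    by simp
  have "(\<integral>\<^sup>+x. ennreal (?f x) * indicator {..0} x \<partial>lborel)
      = (\<integral>\<^sup>+x. ennreal (?f (- x)) * indicator {..0} (- x) \<partial>lborel)"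
    by (subst lborel_distr_uminus[symmetric], subst nn_integral_distr) simp_all
  also have "\<dots> = (\<integral>\<^sup>+x. ennreal (?f x) * indicator {0..} x \<partial>lborel)"
    by (rule nn_integral_cong) (simp add: indicator_def)
  finally have "(\<integral>\<^sup>+x. ennreal (?f x) * indicator {..0} x \<partial>lborel)
      = (\<integral>\<^sup>+x. ennreal (?f x) * indicator {0..} x \<partial>lborel)" .
  with half have "(\<integral>\<^sup>+x. ennreal (?f x) * indicator {0..} x \<partial>lborel)
      + (\<integral>\<^sup>+x. ennreal (?f x) * indicator {..0} x \<partial>lborel) < \<infinity>"
    by simp
  also have "(\<integral>\<^sup>+x. ennreal (?f x) * indicator {0..} x \<partial>lborel)
      + (\<integral>\<^sup>+x. ennreal (?f x) * indicator {..0} x \<partial>lborel)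
      = (\<integral>\<^sup>+x. ennreal (?f x) * indicator {0..} x + ennreal (?f x) * indicator {..0} x \<partial>lborel)"
    by (rule nn_integral_add[symmetric]) auto
  \<comment> \<open>At \<open>x = 0\<close> both indicators are 1, so the sum of the two halves
    dominates the full integrand, which suffices.\<close>
  finally show ?thesis
    by (rule le_less_trans[rotated]) (intro nn_integral_mono, auto split: split_indicator)
qed

lemma nn_integral_lborel_translate:
  fixes f :: "'a::euclidean_space \<Rightarrow> ennreal"
  assumes [measurable]: "f \<in> borel_measurable borel"
  shows "(\<integral>\<^sup>+x. f (c + x) \<partial>lborel) = (\<integral>\<^sup>+x. f x \<partial>lborel)"
  by (subst (2) lborel_distr_plus[of c, symmetric]) (simp add: nn_integral_distr)

text \<open>With the coordinate along \<open>j\<close> integrated last, the other coordinates are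
  merely translated by \<open>m b * t\<close>, which Lebesgue measure ignores. The slopes
  \<open>m\<close> thus drop out of the value; this makes the later bound uniform in the direction
  \<open>w\<close>.\<close>

lemma nn_integral_lborel_shear_prod:
  fixes j :: "'a::euclidean_space" and m :: "'a \<Rightarrow> real" and p q :: "real \<Rightarrow> ennreal"
  assumes j: "j \<in> Basis"
    and [measurable]: "p \<in> borel_measurable borel" "q \<in> borel_measurable borel"
  shows "(\<integral>\<^sup>+x. p (x \<bullet> j) * (\<Prod>b\<in>Basis - {j}. q (x \<bullet> b - m b * (x \<bullet> j))) \<partial>lborel)
    = (\<integral>\<^sup>+x. p x \<partial>lborel) * (\<integral>\<^sup>+x. q x \<partial>lborel) ^ (DIM('a) - 1)"
proof -
  interpret product_sigma_finite "\<lambda>_::'a. lborel :: real measure"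
    by standard
  let ?B = "Basis - {j}"
  let ?G = "\<lambda>y::'a \<Rightarrow> real. p (y j) * (\<Prod>b\<in>?B. q (y b - m b * y j))"
  have B: "insert j ?B = Basis"
    using j by auto
  have [measurable]: "?G \<in> borel_measurable (Pi\<^sub>M (insert j ?B) (\<lambda>_. lborel))"
    by measurable
  have "(\<integral>\<^sup>+x. p (x \<bullet> j) * (\<Prod>b\<in>?B. q (x \<bullet> b - m b * (x \<bullet> j))) \<partial>lborel)
      = (\<integral>\<^sup>+y. ?G y \<partial>Pi\<^sub>M Basis (\<lambda>_. lborel))"
    by (subst lborel_eq, subst nn_integral_distr) (auto intro!: nn_integral_cong prod.cong simp: j)
  also have "\<dots> = (\<integral>\<^sup>+y. ?G y \<partial>Pi\<^sub>M (insert j ?B) (\<lambda>_. lborel))"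
    by (simp only: B)
  also have "\<dots> = (\<integral>\<^sup>+t. (\<integral>\<^sup>+x. ?G (x(j := t)) \<partial>(Pi\<^sub>M ?B (\<lambda>_. lborel))) \<partial>lborel)"
    by (rule product_nn_integral_insert_rev) auto
  also have "\<dots> = (\<integral>\<^sup>+t. p t * (\<integral>\<^sup>+x. q x \<partial>lborel) ^ card ?B \<partial>lborel)"
  proof (rule nn_integral_cong)
    fix t :: real
    have "(\<integral>\<^sup>+x. ?G (x(j := t)) \<partial>(Pi\<^sub>M ?B (\<lambda>_. lborel)))
        = (\<integral>\<^sup>+x. p t * (\<Prod>b\<in>?B. q (x b - m b * t)) \<partial>(Pi\<^sub>M ?B (\<lambda>_. lborel)))"
      by (intro nn_integral_cong arg_cong2[where f = "(*)"] prod.cong) auto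
    also have "\<dots> = p t * (\<integral>\<^sup>+x. (\<Prod>b\<in>?B. q (x b - m b * t)) \<partial>(Pi\<^sub>M ?B (\<lambda>_. lborel)))"
      by (rule nn_integral_cmult) measurable
    also have "(\<integral>\<^sup>+x. (\<Prod>b\<in>?B. q (x b - m b * t)) \<partial>(Pi\<^sub>M ?B (\<lambda>_. lborel)))
        = (\<Prod>b\<in>?B. \<integral>\<^sup>+x. q (x - m b * t) \<partial>lborel)"
      by (rule product_nn_integral_prod) auto
    also have "\<dots> = (\<integral>\<^sup>+x. q x \<partial>lborel) ^ card ?B"
      using nn_integral_lborel_translate[of q "- (m _ * t)"] by (simp add: add.commute)
    finally show "(\<integral>\<^sup>+x. ?G (x(j := t)) \<partial>(Pi\<^sub>M ?B (\<lambda>_. lborel)))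
        = p t * (\<integral>\<^sup>+x. q x \<partial>lborel) ^ card ?B" .
  qed
  also have "\<dots> = (\<integral>\<^sup>+x. p x \<partial>lborel) * (\<integral>\<^sup>+x. q x \<partial>lborel) ^ (DIM('a) - 1)"
    using j by (simp add: nn_integral_multc card_Diff_singleton)
  finally show ?thesis .
qed

section \<open>Domination of the cone kernel by sheared products\<close>

text \<open>Otherwise the l1 norm would fall below the Euclidean norm. For a unit vector, the
  \<open>j\<close> found here keeps all slopes \<open>(w \<bullet> b) / (w \<bullet> j)\<close>
  bounded by the dimension.\<close>

lemma exists_large_coordinate:
  fixes w :: "'a::euclidean_space"
  shows "\<exists>j\<in>Basis. norm w \<le> real DIM('a) * \<bar>w \<bullet> j\<bar>"
proof (rule ccontr)
  assume "\<not> ?thesis"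
  then have "(\<Sum>b\<in>Basis. \<bar>w \<bullet> b\<bar>) < (\<Sum>b\<in>(Basis::'a set). norm w / real DIM('a))"
    by (intro sum_strict_mono) (auto simp: field_simps not_le)
  with norm_le_l1[of w] show False
    by simp
qed

text \<open>\<open>y\<close> is a coordinate of the oblique projection of \<open>x\<close> along \<open>w\<close>, so it is controlled by
  the component of \<open>x\<close> orthogonal to \<open>w\<close>.\<close>

lemma shear_coordinate_bounds:
  fixes w x b j :: "'a::euclidean_space"
  defines "L \<equiv> 1 + real DIM('a)" and "y \<equiv> x \<bullet> b - (w \<bullet> b) / (w \<bullet> j) * (x \<bullet> j)"
  assumes w: "norm w = 1" and b: "b \<in> Basis" and j: "j \<in> Basis"
    and large: "1 \<le> real DIM('a) * \<bar>w \<bullet> j\<bar>"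
  shows "1 + \<bar>y\<bar> \<le> L * (1 + norm x)"
    and "(1 + \<bar>y\<bar>)\<^sup>2 \<le> 8 * L\<^sup>2 * ((1 + norm x) * (1 + norm x - x \<bullet> w))"
proof -
  define z where "z = x - (x \<bullet> w) *\<^sub>R w"
  have ww: "w \<bullet> w = 1"
    using w by (simp add: norm_eq_1)
  have nz: "w \<bullet> j \<noteq> 0"
    using large by auto
  \<comment> \<open>The shear annihilates \<open>w\<close>, so \<open>x\<close> may be replaced by
    its component \<open>z\<close> orthogonal to \<open>w\<close>.\<close>
  have y: "y = z \<bullet> b - (w \<bullet> b) / (w \<bullet> j) * (z \<bullet> j)"
    using nz by (simp add: y_def z_def inner_diff_left field_simps)
  have z2: "(norm z)\<^sup>2 = (norm x)\<^sup>2 - (x \<bullet> w)\<^sup>2"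
    unfolding z_def power2_norm_eq_inner
    by (simp add: inner_diff_left inner_diff_right ww inner_commute power2_eq_square)
  have zb: "\<bar>z \<bullet> b\<bar> \<le> norm z" "\<bar>z \<bullet> j\<bar> \<le> norm z"
    using b j by (auto intro: Basis_le_norm)
  have "\<bar>w \<bullet> b\<bar> \<le> 1"
    using Basis_le_norm[OF b, of w] w by simp
  also note large
  finally have ratio: "\<bar>(w \<bullet> b) / (w \<bullet> j)\<bar> \<le> real DIM('a)"
    using nz by (simp add: abs_divide divide_le_eq)
  have "\<bar>y\<bar> \<le> \<bar>z \<bullet> b\<bar> + \<bar>(w \<bullet> b) / (w \<bullet> j)\<bar> * \<bar>z \<bullet> j\<bar>"
    unfolding y by (simp only: abs_mult[symmetric] abs_triangle_ineq4)
  also have "\<dots> \<le> norm z + real DIM('a) * norm z"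
    using zb ratio by (intro add_mono mult_mono) auto
  finally have yz: "\<bar>y\<bar> \<le> L * norm z"
    by (simp add: L_def algebra_simps)
  have L1: "1 \<le> L"
    by (simp add: L_def)
  have "norm z \<le> norm x"
    by (rule power2_le_imp_le) (simp_all add: z2)
  with yz L1 have yx: "\<bar>y\<bar> \<le> L * norm x"
    using mult_left_mono[of "norm z" "norm x" L] by linarith
  with L1 show "1 + \<bar>y\<bar> \<le> L * (1 + norm x)"
    by (simp add: algebra_simps)
  define R where "R = 1 + norm x"
  define V where "V = 1 + norm x - x \<bullet> w"
  have xw: "\<bar>x \<bullet> w\<bar> \<le> norm x"
    using Cauchy_Schwarz_ineq2[of x w] w by simp
  have RV: "1 \<le> R" "1 \<le> V" "norm x + x \<bullet> w \<le> 2 * R" "norm x - x \<bullet> w \<le> V"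
    using xw by (auto simp: R_def V_def)
  have RV1: "1 \<le> R * V"
    using RV mult_mono[of 1 R 1 V] by simp
  have "y\<^sup>2 \<le> (L * norm z)\<^sup>2"
    using power_mono[OF yz, of 2] by simp
  also have "\<dots> = L\<^sup>2 * ((norm x + x \<bullet> w) * (norm x - x \<bullet> w))"
    by (simp add: power_mult_distrib z2) (simp add: power2_eq_square algebra_simps)
  also have "\<dots> \<le> L\<^sup>2 * ((2 * R) * V)"
    using RV xw by (intro mult_left_mono mult_mono) auto
  finally have y2: "y\<^sup>2 \<le> 2 * L\<^sup>2 * (R * V)"
    by simp
  have "1 \<le> L\<^sup>2 * (R * V)"
    using L1 RV1 mult_mono[of 1 "L\<^sup>2" 1 "R * V"] one_le_power[of L 2] by simp
  \<comment> \<open>This is \<open>(1 - \<bar>y\<bar>)\<^sup>2 \<ge> 0\<close>. By the preceding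
    bounds its right side is at most \<open>6 * L\<^sup>2 * (R * V)\<close>, within the claimed
    factor 8.\<close>
  moreover have "(1 + \<bar>y\<bar>)\<^sup>2 \<le> 2 + 2 * y\<^sup>2"
    using sum_squares_ge_zero[of "1 - \<bar>y\<bar>" 0] by (simp add: power2_eq_square algebra_simps)
  ultimately show "(1 + \<bar>y\<bar>)\<^sup>2 \<le> 8 * L\<^sup>2 * ((1 + norm x) * (1 + norm x - x \<bullet> w))"
    using y2 unfolding R_def V_def by linarith
qed

lemma powr_minus_le_of_le_mult:
  fixes K Y Z r :: real
  assumes "0 < Y" "0 < K" "Y \<le> K * Z" "0 \<le> r"
  shows "Z powr - r \<le> K powr r * Y powr - r"
proof -
  have "0 < K * Z"
    using assms by linarith
  then have Z: "0 < Z"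
    using assms by (simp add: zero_less_mult_iff)
  have "(K * Z) powr - r \<le> Y powr - r"
    using assms by (intro powr_mono2') auto
  then have "K powr r * (K * Z) powr - r \<le> K powr r * Y powr - r"
    by (intro mult_left_mono) auto
  moreover have "K powr r * (K * Z) powr - r = Z powr - r"
    using assms Z by (simp add: powr_mult powr_minus field_simps)
  ultimately show ?thesis
    by simp
qed

text \<open>The exponents come from \<open>R powr -p * V powr -q = R powr -(p - q) * (R * V) powr -q\<close>: each of the
  \<open>n - 1\<close> sheared coordinates receives \<open>(R * V) powr -(d/2) * R powr -(1 - d + e)\<close>, and \<open>e\<close> is
  chosen such that \<open>R powr -(1 + e)\<close> remains for coordinate \<open>j\<close>.\<close>

lemma cone_kernel_le_shear_prod:
  fixes w x j :: "'a::euclidean_space" and p q :: real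
  defines "n \<equiv> real DIM('a)"
  defines "L \<equiv> 1 + n" and "d \<equiv> 2 * q / (n - 1)" and "e \<equiv> (p + q - n) / n"
  assumes w: "norm w = 1" and j: "j \<in> Basis" and large: "1 \<le> n * \<bar>w \<bullet> j\<bar>"
    and q: "0 \<le> q" "2 * q < n - 1" and pq: "p + q > n"
  shows "(1 + norm x) powr - p * (1 + norm x - x \<bullet> w) powr - q
    \<le> (1 + \<bar>x \<bullet> j\<bar>) powr - (1 + e) *
       (\<Prod>b\<in>Basis - {j}. (8 * L\<^sup>2) powr (d / 2) * L powr (1 - d + e) *
          (1 + \<bar>x \<bullet> b - (w \<bullet> b) / (w \<bullet> j) * (x \<bullet> j)\<bar>) powr - (1 + e))"
proof -
  define R where "R = 1 + norm x"
  define V where "V = 1 + norm x - x \<bullet> w"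
  have n: "n > 1" "L > 0"
    using q by (auto simp: L_def)
  \<comment> \<open>The condition \<open>2 * q < n - 1\<close> amounts to \<open>d < 1\<close>, so
    the exponent \<open>1 - d + e\<close> left for \<open>R\<close> is positive.\<close>
  have d: "0 \<le> d" "d < 1" and e: "e > 0"
    using n q pq by (auto simp: d_def e_def field_simps)
  have "\<bar>x \<bullet> w\<bar> \<le> norm x"
    using Cauchy_Schwarz_ineq2[of x w] w by simp
  then have RV: "0 < R" "0 < V"
    by (auto simp: R_def V_def add_pos_nonneg)
  let ?k = "(R * V) powr - (d / 2) * R powr - (1 - d + e)"
  have factor: "?k \<le> (8 * L\<^sup>2) powr (d / 2) * L powr (1 - d + e) *
      (1 + \<bar>x \<bullet> b - (w \<bullet> b) / (w \<bullet> j) * (x \<bullet> j)\<bar>) powr - (1 + e)"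
    if "b \<in> Basis" for b
  proof -
    define Y where "Y = 1 + \<bar>x \<bullet> b - (w \<bullet> b) / (w \<bullet> j) * (x \<bullet> j)\<bar>"
    have Y: "0 < Y" "Y \<le> L * R" "Y\<^sup>2 \<le> 8 * L\<^sup>2 * (R * V)"
      using shear_coordinate_bounds[OF w that j large[unfolded n_def], of x]
      by (auto simp: Y_def L_def n_def R_def V_def add_pos_nonneg)
    \<comment> \<open>The first factor uses the bound on \<open>Y\<^sup>2\<close> by
      \<open>R * V\<close>, the second the bound on \<open>Y\<close> by \<open>R\<close>; the powers
      of \<open>Y\<close> add up to \<open>- (1 + e)\<close>.\<close>
    have "?k \<le> ((8 * L\<^sup>2) powr (d / 2) * (Y\<^sup>2) powr - (d / 2)) *
        (L powr (1 - d + e) * Y powr - (1 - d + e))"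
      using Y n d e by (intro mult_mono powr_minus_le_of_le_mult) auto
    also have "(Y\<^sup>2) powr - (d / 2) = Y powr - d"
      using Y by (simp flip: powr_numeral add: powr_powr)
    also have "((8 * L\<^sup>2) powr (d / 2) * Y powr - d) * (L powr (1 - d + e) * Y powr - (1 - d + e))
        = (8 * L\<^sup>2) powr (d / 2) * L powr (1 - d + e) * (Y powr - d * Y powr - (1 - d + e))"
      by (simp only: mult_ac)
    also have "Y powr - d * Y powr - (1 - d + e) = Y powr - (1 + e)"
      by (simp flip: powr_add)
    finally show ?thesis
      by (simp only: Y_def)
  qed
  have exps: "(n - 1) * (d / 2) = q" "(1 + e) + (n - 1) * (1 - d + e) = p - q"
  proof -
    show "(n - 1) * (d / 2) = q"
      using n by (simp add: d_def divide_simps)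
    moreover have "n * e = p + q - n"
      using n by (simp add: e_def)
    ultimately show "(1 + e) + (n - 1) * (1 - d + e) = p - q"
      by (simp add: algebra_simps)
  qed
  have card: "real (card (Basis - {j})) = n - 1"
    using j by (simp add: n_def card_Diff_singleton of_nat_diff Suc_leI)
  have "?k ^ card (Basis - {j}) = ?k powr (n - 1)"
    using RV by (simp flip: card add: powr_realpow)
  also have "\<dots> = (R * V) powr - q * R powr (- ((n - 1) * (1 - d + e)))"
    using RV by (simp add: powr_mult powr_powr flip: exps(1))
      (simp add: algebra_simps)
  finally have "R powr - (1 + e) * ?k ^ card (Basis - {j})
      = (R * V) powr - q * (R powr - (1 + e) * R powr (- ((n - 1) * (1 - d + e))))"
    by (simp only: mult_ac)
  also have "R powr - (1 + e) * R powr (- ((n - 1) * (1 - d + e))) = R powr (- (p - q))"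
    unfolding exps(2)[symmetric] by (simp flip: powr_add)
  also have "(R * V) powr - q * R powr (- (p - q)) = (R powr - q * R powr (- (p - q))) * V powr - q"
    using RV by (simp add: powr_mult)
  also have "R powr - q * R powr (- (p - q)) = R powr - p"
    by (simp flip: powr_add)
  finally have "R powr - p * V powr - q = R powr - (1 + e) * (\<Prod>b\<in>Basis - {j}. ?k)"
    by simp
  also have "\<dots> \<le> (1 + \<bar>x \<bullet> j\<bar>) powr - (1 + e) *
       (\<Prod>b\<in>Basis - {j}. (8 * L\<^sup>2) powr (d / 2) * L powr (1 - d + e) *
          (1 + \<bar>x \<bullet> b - (w \<bullet> b) / (w \<bullet> j) * (x \<bullet> j)\<bar>) powr - (1 + e))"
    using e factor j Basis_le_norm[OF j, of x]
    by (intro mult_mono prod_mono powr_mono2' prod_nonneg) (auto simp: R_def)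
  finally show ?thesis
    by (simp only: R_def V_def)
qed

text \<open>The dominating product integrates to \<open>I\<close>, in which neither \<open>w\<close>
  nor the chosen \<open>j\<close> appears. It is finite because \<open>p + q\<close> exceeds the
  dimension, that is, \<open>e > 0\<close>.\<close>

lemma nn_integral_cone_kernel_bounded:
  fixes p q :: real
  assumes q: "0 \<le> q" "2 * q < real DIM('a) - 1" and pq: "p + q > real DIM('a)"
  shows "\<exists>K::real. 0 \<le> K \<and> (\<forall>w::'a::euclidean_space. norm w = 1 \<longrightarrow>
    (\<integral>\<^sup>+x. ennreal ((1 + norm x) powr - p * (1 + norm x - x \<bullet> w) powr - q) \<partial>lborel) \<le> ennreal K)"
proof -
  define n where "n = real DIM('a)"
  define e where "e = (p + q - n) / n"
  define d where "d = 2 * q / (n - 1)"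
  define M where "M = (8 * (1 + n)\<^sup>2) powr (d / 2) * (1 + n) powr (1 - d + e)"
  let ?P = "\<lambda>t::real. ennreal ((1 + \<bar>t\<bar>) powr - (1 + e))"
  let ?Q = "\<lambda>t::real. ennreal M * ?P t"
  define I where "I = (\<integral>\<^sup>+t. ?P t \<partial>lborel) * (\<integral>\<^sup>+t. ?Q t \<partial>lborel) ^ (DIM('a) - 1)"
  have "e > 0"
    using q pq by (simp add: e_def n_def)
  then have "I < \<infinity>"
    using nn_integral_one_plus_abs_powr_finite[of e]
    by (simp add: I_def nn_integral_cmult ennreal_mult_less_top power_less_top_ennreal)
  moreover have "(\<integral>\<^sup>+x. ennreal ((1 + norm x) powr - p * (1 + norm x - x \<bullet> w) powr - q) \<partial>lborel) \<le> I"
    if w: "norm w = 1" for w :: 'a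
  proof -
    obtain j :: 'a where j: "j \<in> Basis" and large: "1 \<le> n * \<bar>w \<bullet> j\<bar>"
      using exists_large_coordinate[of w] w by (auto simp: n_def)
    have "(\<integral>\<^sup>+x. ennreal ((1 + norm x) powr - p * (1 + norm x - x \<bullet> w) powr - q) \<partial>lborel)
        \<le> (\<integral>\<^sup>+x. ?P (x \<bullet> j) * (\<Prod>b\<in>Basis - {j}. ?Q (x \<bullet> b - (w \<bullet> b) / (w \<bullet> j) * (x \<bullet> j))) \<partial>lborel)"
    proof (rule nn_integral_mono)
      fix x :: 'a
      have "(1 + norm x) powr - p * (1 + norm x - x \<bullet> w) powr - q
        \<le> (1 + \<bar>x \<bullet> j\<bar>) powr - (1 + e) * (\<Prod>b\<in>Basis - {j}. M *
              (1 + \<bar>x \<bullet> b - (w \<bullet> b) / (w \<bullet> j) * (x \<bullet> j)\<bar>) powr - (1 + e))"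
        using cone_kernel_le_shear_prod[OF w j, of q p x] large q pq
        by (simp add: M_def d_def e_def n_def)
      then have "ennreal ((1 + norm x) powr - p * (1 + norm x - x \<bullet> w) powr - q)
        \<le> ennreal ((1 + \<bar>x \<bullet> j\<bar>) powr - (1 + e) * (\<Prod>b\<in>Basis - {j}. M *
              (1 + \<bar>x \<bullet> b - (w \<bullet> b) / (w \<bullet> j) * (x \<bullet> j)\<bar>) powr - (1 + e)))"
        by (rule ennreal_leI)
      also have "\<dots> = ?P (x \<bullet> j) * (\<Prod>b\<in>Basis - {j}. ?Q (x \<bullet> b - (w \<bullet> b) / (w \<bullet> j) * (x \<bullet> j)))"
        by (simp add: M_def ennreal_mult' prod_nonneg flip: prod_ennreal)
      finally show "ennreal ((1 + norm x) powr - p * (1 + norm x - x \<bullet> w) powr - q)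
          \<le> ?P (x \<bullet> j) * (\<Prod>b\<in>Basis - {j}. ?Q (x \<bullet> b - (w \<bullet> b) / (w \<bullet> j) * (x \<bullet> j)))" .
    qed
    also have "\<dots> = I"
      unfolding I_def by (rule nn_integral_lborel_shear_prod[OF j]) measurable
    finally show ?thesis .
  qed
  ultimately show ?thesis
    by (intro exI[of _ "enn2real I"]) simp
qed

section \<open>Reduction of the weights to the cone kernel\<close>

text \<open>A conjugate factor turns \<open>\<Delta>\<close> into an angular quantity:
  \<open>norm x + norm y + norm (x + y)\<close> times \<open>Delta_plus x y\<close> is
  \<open>2 * (norm x * norm y - x \<bullet> y)\<close>, and for \<open>norm x \<le> norm y\<close>,
  \<open>norm (x + y) + norm y - norm x\<close> times \<open>Delta_minus x y\<close> is
  \<open>2 * (norm x * norm y + x \<bullet> y)\<close>. The factors are at most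
  \<open>4 * norm y\<close> and \<open>2 * norm y\<close>, and \<open>norm y\<close>
  cancels.\<close>

lemma Delta_lower_bound:
  fixes y :: "real ^ 'n"
  assumes "\<Delta> = Delta_plus \<or> \<Delta> = Delta_minus"
  shows "\<exists>w. norm w = 1 \<and> (\<forall>x. norm x \<le> norm y \<longrightarrow> 1 + norm x - x \<bullet> w \<le> 2 * (1 + \<Delta> x y))"
proof (cases "y = 0")
  case True
  \<comment> \<open>Here \<open>norm x \<le> norm y\<close> forces \<open>x = 0\<close>, so any unit
    vector works: the claim reads \<open>1 \<le> 2\<close>.\<close>
  obtain w :: "real ^ 'n" where "norm w = 1"
    using vector_choose_size[of 1] by auto
  then show ?thesis
    using assms True by (intro exI[of _ w]) (auto simp: Delta_plus_def Delta_minus_def)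
next
  case False
  have N2: "norm (x + y) * norm (x + y) = norm x * norm x + norm y * norm y + 2 * (x \<bullet> y)" for x :: "real ^ 'n"
    using dot_norm[of x y] by (simp add: power2_eq_square field_simps)
  from assms show ?thesis
  proof
    assume [simp]: "\<Delta> = Delta_plus"
    show ?thesis
    proof (intro exI[of _ "sgn y"] conjI allI impI)
      fix x :: "real ^ 'n" assume le: "norm x \<le> norm y"
      let ?D = "Delta_plus x y"
      have "2 * norm y * (norm x - x \<bullet> sgn y) = 2 * (norm x * norm y - x \<bullet> y)"
        using False by (simp add: sgn_div_norm algebra_simps)
      also have "\<dots> = ?D * (norm x + norm y + norm (x + y))"
        using N2[of x] by (simp add: Delta_plus_def algebra_simps)
      also have "\<dots> \<le> ?D * (4 * norm y)"
        using le norm_triangle_ineq[of x y] by (intro mult_left_mono) (auto simp: Delta_plus_def)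
      finally have "2 * norm y * (norm x - x \<bullet> sgn y) \<le> 2 * norm y * (2 * ?D)"
        by simp
      then have "norm x - x \<bullet> sgn y \<le> 2 * ?D"
        using False by (subst (asm) mult_le_cancel_left_pos) auto
      then show "1 + norm x - x \<bullet> sgn y \<le> 2 * (1 + \<Delta> x y)"
        by simp
    qed (use False in \<open>simp add: norm_sgn\<close>)
  next
    assume [simp]: "\<Delta> = Delta_minus"
    show ?thesis
    proof (intro exI[of _ "- sgn y"] conjI allI impI)
      fix x :: "real ^ 'n" assume le: "norm x \<le> norm y"
      let ?D = "Delta_minus x y"
      have D: "?D = norm (x + y) + norm x - norm y"
        using le by (simp add: Delta_minus_def)
      have "2 * norm y * (norm x + x \<bullet> sgn y) = 2 * (norm x * norm y + x \<bullet> y)"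
        using False by (simp add: sgn_div_norm algebra_simps)
      also have "\<dots> = ?D * (norm (x + y) + norm y - norm x)"
        using N2[of x] by (simp add: D algebra_simps)
      also have "\<dots> \<le> ?D * (2 * norm y)"
        using norm_triangle_ineq[of x y] norm_triangle_ineq2[of y "- x"]
        by (intro mult_left_mono) (auto simp: D add.commute)
      finally have "2 * norm y * (norm x + x \<bullet> sgn y) \<le> 2 * norm y * ?D"
        by (simp add: mult_ac)
      then have "norm x + x \<bullet> sgn y \<le> ?D"
        using False by (subst (asm) mult_le_cancel_left_pos) auto
      \<comment> \<open>The bound just obtained has constant 1; nonnegativity of \<open>?D\<close>
        weakens it to the factor 2 shared with the other case.\<close>
      moreover have "0 \<le> ?D"
        using norm_triangle_ineq2[of y "- x"] by (simp add: D add.commute)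
      ultimately show "1 + norm x - x \<bullet> - sgn y \<le> 2 * (1 + \<Delta> x y)"
        by simp
    qed (use False in \<open>simp add: norm_sgn\<close>)
  qed
qed

text \<open>The first argument is the smaller frequency, the one integrated while the other is
  fixed. The opposite region uses the same function with \<open>a\<close>, \<open>b\<close> and the
  arguments exchanged; the overlap at equal norms is harmless for upper bounds.\<close>

definition cone_weight ::
  "(real ^ 'n \<Rightarrow> real ^ 'n \<Rightarrow> real) \<Rightarrow> real \<Rightarrow> real \<Rightarrow> real \<Rightarrow> real ^ 'n \<Rightarrow> real ^ 'n \<Rightarrow> real" where
  "cone_weight \<Delta> a b c x y = (if norm x \<le> norm y
     then 1 / (bracket x powr a * bracket y powr b * (1 + \<Delta> x y) powr c) else 0)"

lemma cone_weight_nonneg: "0 \<le> cone_weight \<Delta> a b c x y"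
  by (simp add: cone_weight_def)

lemma borel_measurable_Delta:
  assumes "\<Delta> = Delta_plus \<or> \<Delta> = Delta_minus"
  shows "(\<lambda>z. \<Delta> (fst z) (snd z)) \<in> borel_measurable (borel \<Otimes>\<^sub>M borel)"
  using assms unfolding Delta_plus_def [abs_def] Delta_minus_def [abs_def]
  by (elim disjE) (simp_all, measurable)

lemma borel_measurable_cone_weight:
  assumes "\<Delta> = Delta_plus \<or> \<Delta> = Delta_minus"
  shows "(\<lambda>z. cone_weight \<Delta> a b c (fst z) (snd z)) \<in> borel_measurable (borel \<Otimes>\<^sub>M borel)"
proof -
  note [measurable] = borel_measurable_Delta[OF assms]
  show ?thesis
    unfolding cone_weight_def bracket_def by measurable
qed

text \<open>On the support, \<open>norm x \<le> norm y\<close> and \<open>0 \<le> b\<close> let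
  decay in \<open>y\<close> be traded for decay in \<open>x\<close>. Squaring gives the cone kernel
  with \<open>p = 2 * (a + b)\<close> and \<open>q = 2 * c\<close>, whose two conditions are exactly
  those on \<open>a + b + c\<close> and \<open>c\<close>.\<close>

lemma nn_integral_cone_weight_bounded:
  fixes \<Delta> :: "real ^ 'n \<Rightarrow> real ^ 'n \<Rightarrow> real"
  assumes abc: "0 \<le> b" "0 \<le> c" "a + b + c > real CARD('n) / 2" "c < (real CARD('n) - 1) / 4"
    and \<Delta>: "\<Delta> = Delta_plus \<or> \<Delta> = Delta_minus"
  shows "\<exists>A\<ge>0. \<forall>y. (\<integral>\<^sup>+x. (ennreal (cone_weight \<Delta> a b c x y))\<^sup>2 \<partial>lborel) \<le> ennreal A"
proof -
  obtain K where K: "0 \<le> K" "\<And>w :: real ^ 'n. norm w = 1 \<Longrightarrow>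
      (\<integral>\<^sup>+x. ennreal ((1 + norm x) powr - (2 * (a + b)) * (1 + norm x - x \<bullet> w) powr - (2 * c)) \<partial>lborel)
      \<le> ennreal K"
    using nn_integral_cone_kernel_bounded[where 'a = "real ^ 'n", of "2 * c" "2 * (a + b)"] abc by auto
  have "(\<integral>\<^sup>+x. (ennreal (cone_weight \<Delta> a b c x y))\<^sup>2 \<partial>lborel) \<le> ennreal (2 powr (2 * c) * K)" for y
  proof -
    obtain w where w: "norm w = 1"
      and low: "\<And>x. norm x \<le> norm y \<Longrightarrow> 1 + norm x - x \<bullet> w \<le> 2 * (1 + \<Delta> x y)"
      using Delta_lower_bound[OF \<Delta>] by blast
    have "(cone_weight \<Delta> a b c x y)\<^sup>2 \<le> 2 powr (2 * c) *
        ((1 + norm x) powr - (2 * (a + b)) * (1 + norm x - x \<bullet> w) powr - (2 * c))" for x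
    proof (cases "norm x \<le> norm y")
      case True
      define V where "V = 1 + norm x - x \<bullet> w"
      have "\<bar>x \<bullet> w\<bar> \<le> norm x"
        using Cauchy_Schwarz_ineq2[of x w] w by simp
      then have V: "0 < V" "V \<le> 2 * (1 + \<Delta> x y)"
        using low[OF True] by (auto simp: V_def)
      have "cone_weight \<Delta> a b c x y
          = (1 + norm x) powr - a * (1 + norm y) powr - b * (1 + \<Delta> x y) powr - c"
        using True by (simp add: cone_weight_def bracket_def powr_minus divide_inverse)
      also have "\<dots> \<le> (1 + norm x) powr - a * (1 + norm x) powr - b * (2 powr c * V powr - c)"
        using True abc V
        by (intro mult_mono powr_minus_le_of_le_mult powr_mono2' order_refl) (auto simp: add_pos_nonneg)
      also have "\<dots> = 2 powr c * ((1 + norm x) powr - (a + b) * V powr - c)"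
        by (simp add: powr_add[symmetric] mult_ac)
      finally have "(cone_weight \<Delta> a b c x y)\<^sup>2
          \<le> (2 powr c * ((1 + norm x) powr - (a + b) * V powr - c))\<^sup>2"
        by (rule power_mono) (rule cone_weight_nonneg)
      also have "\<dots> = 2 powr (2 * c) * ((1 + norm x) powr - (2 * (a + b)) * V powr - (2 * c))"
      proof -
        have sq: "(X powr r)\<^sup>2 = X powr (2 * r)" for X r :: real
          by (simp add: power2_eq_square flip: powr_add)
        show ?thesis
          unfolding power_mult_distrib sq by simp
      qed
      finally show ?thesis
        by (simp only: V_def)
    qed (simp add: cone_weight_def)
    then have "(\<integral>\<^sup>+x. (ennreal (cone_weight \<Delta> a b c x y))\<^sup>2 \<partial>lborel)
        \<le> (\<integral>\<^sup>+x. ennreal (2 powr (2 * c)) *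
            ennreal ((1 + norm x) powr - (2 * (a + b)) * (1 + norm x - x \<bullet> w) powr - (2 * c)) \<partial>lborel)"
      by (intro nn_integral_mono)
         (simp add: ennreal_power cone_weight_nonneg ennreal_leI flip: ennreal_mult')
    also have "\<dots> = ennreal (2 powr (2 * c)) * (\<integral>\<^sup>+x.
            ennreal ((1 + norm x) powr - (2 * (a + b)) * (1 + norm x - x \<bullet> w) powr - (2 * c)) \<partial>lborel)"
      by (rule nn_integral_cmult) measurable
    also have "\<dots> \<le> ennreal (2 powr (2 * c)) * ennreal K"
      by (intro mult_left_mono K w) simp
    finally show ?thesis
      by (simp add: ennreal_mult')
  qed
  with K(1) show ?thesis
    by (intro exI[of _ "2 powr (2 * c) * K"]) simp
qed

section \<open>Cauchy-Schwarz for the trilinear form\<close>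

lemma ennreal_le_of_power2_le:
  assumes "X\<^sup>2 \<le> ennreal (r\<^sup>2)" "0 \<le> r"
  shows "X \<le> ennreal r"
proof (cases X)
  case (real t)
  then show ?thesis
    using assms by (simp add: ennreal_power power2_le_iff_abs_le)
next
  case top
  then show ?thesis
    using assms by (simp add: top_power_ennreal top_unique)
qed

text \<open>After Cauchy-Schwarz both square integrals decouple by Fubini: integrating over
  \<open>y\<close> first frees \<open>h (x + y)\<close> from \<open>x\<close> by translation
  invariance, and integrating over \<open>x\<close> first leaves only \<open>W\<close>, controlled
  by \<open>A\<close>.\<close>

lemma nn_integral_trilinear_le:
  fixes f g h :: "'a::euclidean_space \<Rightarrow> ennreal" and W :: "'a \<Rightarrow> 'a \<Rightarrow> ennreal"
  assumes [measurable]: "f \<in> borel_measurable borel" "g \<in> borel_measurable borel"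
      "h \<in> borel_measurable borel" "case_prod W \<in> borel_measurable (borel \<Otimes>\<^sub>M borel)"
    and W: "\<And>y. (\<integral>\<^sup>+x. (W x y)\<^sup>2 \<partial>lborel) \<le> ennreal A" and "0 \<le> A"
    and f: "(\<integral>\<^sup>+x. (f x)\<^sup>2 \<partial>lborel) = ennreal (F\<^sup>2)" "0 \<le> F"
    and g: "(\<integral>\<^sup>+x. (g x)\<^sup>2 \<partial>lborel) = ennreal (G\<^sup>2)" "0 \<le> G"
    and h: "(\<integral>\<^sup>+x. (h x)\<^sup>2 \<partial>lborel) = ennreal (H\<^sup>2)" "0 \<le> H"
  shows "(\<integral>\<^sup>+y. \<integral>\<^sup>+x. f x * g y * h (x + y) * W x y \<partial>lborel \<partial>lborel) \<le> ennreal (sqrt A * F * G * H)"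
proof (rule ennreal_le_of_power2_le)
  let ?M = "lborel \<Otimes>\<^sub>M lborel :: ('a \<times> 'a) measure"
  let ?u = "\<lambda>z. f (fst z) * h (fst z + snd z)"
  let ?v = "\<lambda>z. g (snd z) * W (fst z) (snd z)"
  have "(\<integral>\<^sup>+y. \<integral>\<^sup>+x. f x * g y * h (x + y) * W x y \<partial>lborel \<partial>lborel) = (\<integral>\<^sup>+z. ?u z * ?v z \<partial>?M)"
    by (subst lborel_pair.nn_integral_snd[symmetric]) (simp_all add: mult_ac)
  also have "\<dots>\<^sup>2 \<le> (\<integral>\<^sup>+z. (?u z)\<^sup>2 \<partial>?M) * (\<integral>\<^sup>+z. (?v z)\<^sup>2 \<partial>?M)"
    by (rule Cauchy_Schwarz_nn_integral) measurable
  also have "(\<integral>\<^sup>+z. (?u z)\<^sup>2 \<partial>?M) = (\<integral>\<^sup>+x. \<integral>\<^sup>+y. (f x)\<^sup>2 * (h (x + y))\<^sup>2 \<partial>lborel \<partial>lborel)"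
    by (subst lborel.nn_integral_fst[symmetric]) (simp_all add: power_mult_distrib)
  also have "\<dots> = (\<integral>\<^sup>+x. (f x)\<^sup>2 * ennreal (H\<^sup>2) \<partial>lborel)"
    using nn_integral_lborel_translate[of "\<lambda>y. (h y)\<^sup>2"] by (simp add: nn_integral_cmult h)
  also have "\<dots> = ennreal (F\<^sup>2) * ennreal (H\<^sup>2)"
    by (simp add: nn_integral_multc f)
  also have "(\<integral>\<^sup>+z. (?v z)\<^sup>2 \<partial>?M) = (\<integral>\<^sup>+y. \<integral>\<^sup>+x. (g y)\<^sup>2 * (W x y)\<^sup>2 \<partial>lborel \<partial>lborel)"
    by (subst lborel_pair.nn_integral_snd[symmetric]) (simp_all add: power_mult_distrib)
  also have "\<dots> = (\<integral>\<^sup>+y. (g y)\<^sup>2 * (\<integral>\<^sup>+x. (W x y)\<^sup>2 \<partial>lborel) \<partial>lborel)"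
    by (simp add: nn_integral_cmult)
  also have "\<dots> \<le> (\<integral>\<^sup>+y. (g y)\<^sup>2 * ennreal A \<partial>lborel)"
    by (intro nn_integral_mono mult_left_mono W) simp
  also have "\<dots> = ennreal (G\<^sup>2) * ennreal A"
    by (simp add: nn_integral_multc g)
  also have "ennreal (F\<^sup>2) * ennreal (H\<^sup>2) * (ennreal (G\<^sup>2) * ennreal A)
      = ennreal ((sqrt A * F * G * H)\<^sup>2)"
    using \<open>0 \<le> A\<close> by (simp add: power_mult_distrib mult_ac flip: ennreal_mult')
  finally show "(\<integral>\<^sup>+y. \<integral>\<^sup>+x. f x * g y * h (x + y) * W x y \<partial>lborel \<partial>lborel)\<^sup>2
      \<le> ennreal ((sqrt A * F * G * H)\<^sup>2)"
    by (simp add: mult_left_mono)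
qed (use assms in simp)

section \<open>Borel representatives and null sets\<close>

text \<open>The Fubini arguments run on Borel functions, whose compositions with projections and
  addition stay Borel; a change on a null set keeps the norm.\<close>

lemma L2_fun_borel_representative:
  assumes "f \<in> L2_fun"
  obtains f' where "f' \<in> borel_measurable borel" "AE x in lborel. f x = f' x"
    "(\<integral>\<^sup>+x. (ennreal \<bar>f' x\<bar>)\<^sup>2 \<partial>lborel) = ennreal ((L2_norm f)\<^sup>2)"
proof -
  from assms have f: "f \<in> borel_measurable lebesgue" "integrable lebesgue (\<lambda>x. (f x)\<^sup>2)"
    by (auto simp: L2_fun_def)
  from completion_ex_borel_measurable_real[OF f(1)]
  obtain f' where f': "f' \<in> borel_measurable borel" "AE x in lborel. f x = f' x"
    by auto
  have "(\<integral>\<^sup>+x. (ennreal \<bar>f' x\<bar>)\<^sup>2 \<partial>lborel) = (\<integral>\<^sup>+x. ennreal ((f x)\<^sup>2) \<partial>lborel)"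
    by (rule nn_integral_cong_AE, use f'(2) in eventually_elim) (simp add: ennreal_power)
  also have "\<dots> = (\<integral>\<^sup>+x. ennreal ((f x)\<^sup>2) \<partial>lebesgue)"
    by (simp add: nn_integral_completion)
  also have "\<dots> = ennreal ((L2_norm f)\<^sup>2)"
    using f(2) by (simp add: nn_integral_eq_integral L2_norm_def)
  finally show ?thesis
    using f' that by blast
qed

text \<open>The exceptional sets are contained in preimages of a Borel null set \<open>N\<close>
  under the projections and addition. For \<open>x\<close> outside \<open>N\<close> their slices are
  empty, \<open>N\<close> or a translate of \<open>N\<close>, hence null, and Fubini
  applies.\<close>

lemma AE_lborel_pair:
  fixes P :: "'a::euclidean_space \<Rightarrow> bool"
  assumes "AE x in lborel. P x"
  shows "AE z in (lborel :: ('a \<times> 'a) measure). P (fst z) \<and> P (snd z) \<and> P (fst z + snd z)"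
proof -
  obtain N where N: "N \<in> null_sets lborel" "{x \<in> space lborel. \<not> P x} \<subseteq> N"
    using assms unfolding eventually_ae_filter by blast
  then have [measurable]: "N \<in> sets borel"
    by auto
  have AE_N: "AE x in lborel. x \<notin> N"
    using N(1) by (rule AE_not_in)
  have "AE y in lborel. x + y \<notin> N" for x
    using AE_N by (subst (asm) lborel_distr_plus[of x, symmetric]) (simp add: AE_distr_iff)
  then have "AE y in lborel. y \<notin> N \<and> x + y \<notin> N" for x
    using AE_N by (rule AE_conjI[rotated])
  then have iter: "AE x in lborel. AE y in lborel. x \<notin> N \<and> y \<notin> N \<and> x + y \<notin> N"
    by - (rule eventually_mono[OF AE_N], simp)
  have "AE z in lborel \<Otimes>\<^sub>M lborel. fst z \<notin> N \<and> snd z \<notin> N \<and> fst z + snd z \<notin> N"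
  proof (rule lborel_pair.AE_pair_measure)
    show "{z \<in> space (lborel \<Otimes>\<^sub>M lborel). fst z \<notin> N \<and> snd z \<notin> N \<and> fst z + snd z \<notin> N}
        \<in> sets (lborel \<Otimes>\<^sub>M lborel)"
      by measurable
  qed (use iter in simp)
  then show ?thesis
    unfolding lborel_prod by eventually_elim (use N(2) in auto)
qed

section \<open>Assembly of the two regions\<close>

theorem proposition1p2:
  fixes a b c :: real
    and \<Delta> :: "real ^ 'n \<Rightarrow> real ^ 'n \<Rightarrow> real"
  assumes "a \<ge> 0" and "b \<ge> 0" and "c \<ge> 0"
    and "a + b + c > real CARD('n) / 2"
    and "c < (real CARD('n) - 1) / 4"
    and "\<Delta> = Delta_plus \<or> \<Delta> = Delta_minus"
  shows "\<exists>C::real. \<forall>f \<in> L2_fun. \<forall>g \<in> L2_fun. \<forall>h \<in> L2_fun.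
    integrable lebesgue (trilinear_integrand \<Delta> a b c f g h) \<and>
    integral\<^sup>L lebesgue (trilinear_integrand \<Delta> a b c f g h)
      \<le> C * L2_norm f * L2_norm g * L2_norm h"
proof -
  obtain A where A: "0 \<le> A"
      "\<And>y. (\<integral>\<^sup>+x. (ennreal (cone_weight \<Delta> a b c x y))\<^sup>2 \<partial>lborel) \<le> ennreal A"
    using nn_integral_cone_weight_bounded[of b c a \<Delta>] assms by auto
  obtain B where B: "0 \<le> B"
      "\<And>y. (\<integral>\<^sup>+x. (ennreal (cone_weight \<Delta> b a c x y))\<^sup>2 \<partial>lborel) \<le> ennreal B"
    using nn_integral_cone_weight_bounded[of a c b \<Delta>] assms by (auto simp: add_ac)
  show ?thesis
  proof (intro exI[of _ "sqrt A + sqrt B"] ballI)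
    fix f g h :: "real ^ 'n \<Rightarrow> real"
    assume "f \<in> L2_fun" "g \<in> L2_fun" "h \<in> L2_fun"
    obtain f' where f'[measurable]: "f' \<in> borel_measurable borel" and f'_eq: "AE x in lborel. f x = f' x"
      and f'_L2: "(\<integral>\<^sup>+x. (ennreal \<bar>f' x\<bar>)\<^sup>2 \<partial>lborel) = ennreal ((L2_norm f)\<^sup>2)"
      using \<open>f \<in> L2_fun\<close> by (rule L2_fun_borel_representative)
    obtain g' where g'[measurable]: "g' \<in> borel_measurable borel" and g'_eq: "AE x in lborel. g x = g' x"
      and g'_L2: "(\<integral>\<^sup>+x. (ennreal \<bar>g' x\<bar>)\<^sup>2 \<partial>lborel) = ennreal ((L2_norm g)\<^sup>2)"
      using \<open>g \<in> L2_fun\<close> by (rule L2_fun_borel_representative)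
    obtain h' where h'[measurable]: "h' \<in> borel_measurable borel" and h'_eq: "AE x in lborel. h x = h' x"
      and h'_L2: "(\<integral>\<^sup>+x. (ennreal \<bar>h' x\<bar>)\<^sup>2 \<partial>lborel) = ennreal ((L2_norm h)\<^sup>2)"
      using \<open>h \<in> L2_fun\<close> by (rule L2_fun_borel_representative)
    note L2 = f'_L2 g'_L2 h'_L2
    note ae = f'_eq[THEN AE_lborel_pair] g'_eq[THEN AE_lborel_pair] h'_eq[THEN AE_lborel_pair]
    let ?T = "trilinear_integrand \<Delta> a b c f g h"
    let ?T' = "trilinear_integrand \<Delta> a b c f' g' h'"
    let ?C = "(sqrt A + sqrt B) * L2_norm f * L2_norm g * L2_norm h"
    have [simp]: "0 \<le> L2_norm u" for u :: "real ^ 'n \<Rightarrow> real"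
      by (simp add: L2_norm_def)
    have [measurable]: "(\<lambda>z. \<Delta> (fst z) (snd z)) \<in> borel_measurable (borel \<Otimes>\<^sub>M borel)"
      by (rule borel_measurable_Delta) fact
    have [measurable]:
        "(\<lambda>z. cone_weight \<Delta> a b c (fst z) (snd z)) \<in> borel_measurable (borel \<Otimes>\<^sub>M borel)"
        "(\<lambda>z. cone_weight \<Delta> b a c (fst z) (snd z)) \<in> borel_measurable (borel \<Otimes>\<^sub>M borel)"
      by (rule borel_measurable_cone_weight, fact)+
    have [measurable]:
        "(\<lambda>z. cone_weight \<Delta> b a c (snd z) (fst z)) \<in> borel_measurable (borel \<Otimes>\<^sub>M borel)"
      using measurable_compose[OF measurable_Pair[OF measurable_snd measurable_fst]
          borel_measurable_cone_weight[OF assms(6)]] by simp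
    have "?T' \<in> borel_measurable (lborel \<Otimes>\<^sub>M lborel)"
      unfolding trilinear_integrand_def case_prod_unfold bracket_def by measurable
    then have T'_meas: "?T' \<in> borel_measurable lborel"
      by (simp only: lborel_prod)
    \<comment> \<open>\<open>?V\<close> is \<open>?U\<close> with \<open>f'\<close>,
      \<open>g'\<close> and \<open>a\<close>, \<open>b\<close> exchanged, so \<open>?V y x\<close>
      covers the region where \<open>y\<close> is the smaller frequency and the same trilinear bound
      serves both.\<close>
    let ?U = "\<lambda>x y. ennreal \<bar>f' x\<bar> * ennreal \<bar>g' y\<bar> * ennreal \<bar>h' (x + y)\<bar> * ennreal (cone_weight \<Delta> a b c x y)"
    let ?V = "\<lambda>x y. ennreal \<bar>g' x\<bar> * ennreal \<bar>f' y\<bar> * ennreal \<bar>h' (x + y)\<bar> * ennreal (cone_weight \<Delta> b a c x y)"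
    have le: "ennreal (norm (?T' (x, y))) \<le> ?U x y + ?V y x" for x y
    proof -
      have sym: "\<Delta> y x = \<Delta> x y"
        using assms(6) by (auto simp: Delta_plus_def Delta_minus_def add.commute abs_minus_commute)
      let ?q = "1 / (bracket x powr a * bracket y powr b * (1 + \<Delta> x y) powr c)"
      have "?q \<le> cone_weight \<Delta> a b c x y + cone_weight \<Delta> b a c y x"
      proof (cases "norm x \<le> norm y")
        case True
        then have "?q = cone_weight \<Delta> a b c x y"
          by (simp add: cone_weight_def)
        then show ?thesis
          by (simp only: le_add_same_cancel1 cone_weight_nonneg)
      next
        case False
        then have "?q = cone_weight \<Delta> b a c y x"
          by (simp add: cone_weight_def sym mult_ac)
        then show ?thesis
          by (simp only: le_add_same_cancel2 cone_weight_nonneg)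
      qed
      then have "\<bar>f' x\<bar> * \<bar>g' y\<bar> * \<bar>h' (x + y)\<bar> * ?q \<le> \<bar>f' x\<bar> * \<bar>g' y\<bar> * \<bar>h' (x + y)\<bar> *
          (cone_weight \<Delta> a b c x y + cone_weight \<Delta> b a c y x)"
        by (rule mult_left_mono) simp
      also have "\<bar>f' x\<bar> * \<bar>g' y\<bar> * \<bar>h' (x + y)\<bar> * ?q = norm (?T' (x, y))"
        by (simp add: trilinear_integrand_def abs_mult)
      finally have "norm (?T' (x, y)) \<le> \<bar>f' x\<bar> * \<bar>g' y\<bar> * \<bar>h' (x + y)\<bar> *
          (cone_weight \<Delta> a b c x y + cone_weight \<Delta> b a c y x)" .
      then have "ennreal (norm (?T' (x, y))) \<le> ennreal (\<bar>f' x\<bar> * \<bar>g' y\<bar> * \<bar>h' (x + y)\<bar> *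
          (cone_weight \<Delta> a b c x y + cone_weight \<Delta> b a c y x))"
        by (rule ennreal_leI)
      also have "\<dots> = ?U x y + ?V y x"
        by (simp add: ennreal_mult' ennreal_plus cone_weight_nonneg distrib_left mult_ac add.commute)
      finally show ?thesis .
    qed
    have "(\<integral>\<^sup>+z. ennreal (norm (?T' z)) \<partial>lborel)
        \<le> (\<integral>\<^sup>+z. ?U (fst z) (snd z) + ?V (snd z) (fst z) \<partial>(lborel \<Otimes>\<^sub>M lborel))"
      unfolding lborel_prod by (rule nn_integral_mono) (use le in auto)
    also have "\<dots> = (\<integral>\<^sup>+z. ?U (fst z) (snd z) \<partial>(lborel \<Otimes>\<^sub>M lborel))
        + (\<integral>\<^sup>+z. ?V (snd z) (fst z) \<partial>(lborel \<Otimes>\<^sub>M lborel))"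
      by (rule nn_integral_add) measurable
    also have "(\<integral>\<^sup>+z. ?U (fst z) (snd z) \<partial>(lborel \<Otimes>\<^sub>M lborel))
        = (\<integral>\<^sup>+y. \<integral>\<^sup>+x. ?U x y \<partial>lborel \<partial>lborel)"
      by (subst lborel_pair.nn_integral_snd[symmetric]) simp_all
    also have "\<dots> \<le> ennreal (sqrt A * L2_norm f * L2_norm g * L2_norm h)"
      by (rule nn_integral_trilinear_le) (auto simp: A L2 case_prod_unfold)
    also have "(\<integral>\<^sup>+z. ?V (snd z) (fst z) \<partial>(lborel \<Otimes>\<^sub>M lborel))
        = (\<integral>\<^sup>+x. \<integral>\<^sup>+y. ?V y x \<partial>lborel \<partial>lborel)"
      by (subst lborel.nn_integral_fst[symmetric]) simp_all
    also have "\<dots> \<le> ennreal (sqrt B * L2_norm g * L2_norm f * L2_norm h)"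
      by (rule nn_integral_trilinear_le) (auto simp: B L2 case_prod_unfold)
    also have "ennreal (sqrt A * L2_norm f * L2_norm g * L2_norm h) +
        ennreal (sqrt B * L2_norm g * L2_norm f * L2_norm h) = ennreal ?C"
      using A B by (simp add: algebra_simps flip: ennreal_plus)
    finally have bound: "(\<integral>\<^sup>+z. ennreal (norm (?T' z)) \<partial>lborel) \<le> ennreal ?C"
      by (simp add: add_mono)
    then have "integrable lborel ?T'"
      using T'_meas by (intro integrableI_bounded) (auto intro: le_less_trans)
    then have int': "integrable lebesgue ?T'"
      using T'_meas by (simp add: integrable_completion)
    have "AE z in lborel. ?T' z = ?T z"
      using ae
      by eventually_elim (simp add: trilinear_integrand_def case_prod_unfold)
    then have ae_T: "AE z in lebesgue. ?T' z = ?T z"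
      by (rule AE_completion)
    have T_meas: "?T \<in> borel_measurable lebesgue"
      using borel_measurable_integrable[OF int'] ae_T by (rule borel_measurable_AE)
    have int: "integrable lebesgue ?T"
      using int' T_meas ae_T by (rule integrable_cong_AE_imp)
    have "integral\<^sup>L lebesgue ?T = integral\<^sup>L lebesgue ?T'"
      using T_meas borel_measurable_integrable[OF int'] ae_T
      by (intro integral_cong_AE) (auto simp: eq_commute)
    \<comment> \<open>Passing to \<open>ennreal\<close> truncates a negative integral to 0, which
      loses nothing because \<open>?C\<close> is nonnegative.\<close>
    also have "ennreal \<dots> \<le> ennreal ?C"
    proof -
      have "ennreal (integral\<^sup>L lebesgue ?T') \<le> ennreal (norm (integral\<^sup>L lebesgue ?T'))"
        by (intro ennreal_leI) simp
      also have "\<dots> \<le> (\<integral>\<^sup>+z. ennreal (norm (?T' z)) \<partial>lebesgue)"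
        using int' by (rule integral_norm_bound_ennreal)
      finally show ?thesis
        using bound by (simp add: nn_integral_completion)
    qed
    finally have "integral\<^sup>L lebesgue ?T \<le> ?C"
      using A B by (simp add: ennreal_le_iff)
    with int show "integrable lebesgue ?T \<and> integral\<^sup>L lebesgue ?T \<le> ?C"
      by blast
  qed
qed

end
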